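(* Let $\{r_n\}_{n\ge1}$ be a nonnegative stochastic process adapted to a filtration $\{\mathcal F_n\}$ with $\sup_{n\ge1}|r_n|<+\infty$ almost surely, and let $\{\beta_n\}$, $\{\eta_n\}$ be positive sequences. Suppose that $$\mathbb E[r_{n+2}\mid\mathcal F_{n+1}]\le\big((1+y_n)r_{n+1}-y_nr_n\big)+\beta_n-\eta_n,\qquad n\ge1,$$ where $y_n\in[c,d]\subset(0,1)$ for all $n\ge1$, and $\sum_{n=1}^\infty\beta_n<\infty$ almost surely. Then $r_n$ converges almost surely to some finite random variable, and $\sum_{k=1}^\infty\eta_k<+\infty$ almost surely.
   Context: All random variables are real-valued and live on a common probability space; $\{y_n\}$ is a deterministic sequence; $\beta_n$ and $\eta_n$ may be random, in which case they are $\mathcal F_{n+1}$-measurable; inequalities between random variables hold almost surely. *)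

theory Defs
  imports "HOL-Probability.Probability"
begin

text \<open>
  Conditional expectation of a nonnegative random variable, valued in \<open>[0, \<infinity>]\<close>, so that no
  integrability of \<open>X\<close> is needed.  The detour from \<^typ>\<open>ennreal\<close> to \<^typ>\<open>ereal\<close> allows
  comparison with real numbers without truncating negative ones at \<open>0\<close>; and, unlike
  \<^const>\<open>real_cond_exp\<close>, which is \<open>0\<close> wherever the conditional expectation is infinite,
  an upper bound \<open>nonneg_cond_exp M F X \<omega> \<le> ereal a\<close> asserts finiteness.
\<close>

definition nonneg_cond_exp :: "'a measure \<Rightarrow> 'a measure \<Rightarrow> ('a \<Rightarrow> real) \<Rightarrow> 'a \<Rightarrow> ereal" where
  "nonneg_cond_exp M F X \<omega> = enn2ereal (nn_cond_exp M F (\<lambda>\<omega>. ennreal (X \<omega>)) \<omega>)"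

lemma (in sigma_finite_subalgebra) nonneg_cond_exp_eq_real_cond_exp:
  assumes "integrable M X" "AE \<omega> in M. 0 \<le> X \<omega>"
  shows "AE \<omega> in M. nonneg_cond_exp M F X \<omega> = ereal (real_cond_exp M F X \<omega>)"
proof -
  have [measurable]: "X \<in> borel_measurable M" using assms(1) by simp
  have neg: "AE \<omega> in M. nn_cond_exp M F (\<lambda>x. ennreal (- X x)) \<omega> = 0"
  proof -
    have "AE \<omega> in M. nn_cond_exp M F (\<lambda>x. ennreal (- X x)) \<omega> = nn_cond_exp M F (\<lambda>x. 0) \<omega>"
      by (rule nn_cond_exp_cong) (use assms(2) in \<open>auto simp: ennreal_neg\<close>)
    moreover have "AE \<omega> in M. 0 = nn_cond_exp M F (\<lambda>x. 0) \<omega>"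
      by (rule nn_cond_exp_F_meas) simp
    ultimately show ?thesis by (auto elim: AE_mp)
  qed
  have "(\<integral>\<^sup>+ x. nn_cond_exp M F (\<lambda>x. ennreal (X x)) x \<partial>M) = (\<integral>\<^sup>+ x. ennreal (X x) \<partial>M)"
    using nn_cond_exp_intg[of "\<lambda>_. 1" "\<lambda>x. ennreal (X x)"] by simp
  also have "\<dots> \<noteq> \<infinity>"
    using integrableD(2)[OF assms(1)] by simp
  finally have "AE \<omega> in M. nn_cond_exp M F (\<lambda>x. ennreal (X x)) \<omega> \<noteq> \<infinity>"
    by (intro nn_integral_PInf_AE) auto
  with neg show ?thesis
  proof eventually_elim
    case (elim \<omega>)
    then show ?case
      by (cases "nn_cond_exp M F (\<lambda>x. ennreal (X x)) \<omega>")
        (auto simp: nonneg_cond_exp_def real_cond_exp_def enn2ereal_ennreal)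
  qed
qed

end

theory Submission
  imports Defs
begin

text \<open>
  The coefficients \<open>a n = (\<Sum>k. \<Prod>i<k. y (n + i))\<close> solve \<open>a n = 1 + y n * a (Suc n)\<close> and lie between
  \<open>1\<close> and \<open>1 / (1 - d)\<close>.  With them the second-order inequality becomes a first-order one: the
  potential \<open>U n = r n + a n * (r (Suc n) - r n)\<close> has conditional drift at most
  \<open>a (Suc n) * (\<beta> n - \<eta> n)\<close>, so subtracting the cumulated drift from \<open>U\<close> gives a supermartingale.
  Nothing is integrable here, but on the decreasing events where \<open>r\<close> and the partial sums of
  \<open>\<beta>\<close> have stayed below a constant \<open>K\<close> this process is bounded below; shifted and set to \<open>0\<close> off these
  events, it is a nonnegative supermartingale and converges by Doob's upcrossing argument.
  Almost every path stays in these events for some \<open>K\<close>.  On it the partial sums of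
  \<open>a (Suc n) * \<eta> n\<close> are bounded, hence \<open>\<eta>\<close> is summable and \<open>U\<close> converges; and
  \<open>r (Suc n) = (1 - 1 / a n) * r n + U n / a n\<close> is a contraction driven by \<open>U\<close>, so \<open>r\<close> has the
  same limit.
\<close>

section \<open>Counting crossings of a sequence in \<open>ennreal\<close>\<close>

text \<open>The parity of the state tells what the sequence waits for next: a value at most \<open>a\<close> in an
  even state, a value at least \<open>b\<close> in an odd one.\<close>

primrec crossings :: "ennreal \<Rightarrow> ennreal \<Rightarrow> (nat \<Rightarrow> ennreal) \<Rightarrow> nat \<Rightarrow> nat" where
  "crossings a b x 0 = 0"
| "crossings a b x (Suc n) = (let s = crossings a b x n in
     if (if even s then x (Suc n) \<le> a else b \<le> x (Suc n)) then Suc s else s)"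

lemma crossings_mono: "incseq (crossings a b x)"
  by (rule incseq_SucI) (auto simp: Let_def)

text \<open>The count cannot stay at \<open>k\<close> forever: the parity of \<open>k\<close> fixes
  which of the two events is awaited, and either one occurs infinitely often.\<close>

lemma crossings_unbounded:
  assumes "frequently (\<lambda>n. x n \<le> a) sequentially" "frequently (\<lambda>n. b \<le> x n) sequentially"
  shows "\<exists>n. k \<le> crossings a b x n"
proof (induction k)
  case (Suc k)
  then obtain n where n: "k \<le> crossings a b x n" by blast
  show ?case
  proof (rule ccontr)
    assume "\<not> ?thesis"
    then have const: "crossings a b x m = k" if "m \<ge> n" for m
    proof -
      have "\<not> Suc k \<le> crossings a b x m"
        using \<open>\<not> (\<exists>n. Suc k \<le> crossings a b x n)\<close> by blast
      then show ?thesis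
        using n incseqD[OF crossings_mono[of a b x] that] by simp
    qed
    have "frequently (\<lambda>m. if even k then x m \<le> a else b \<le> x m) sequentially"
      using assms by (cases "even k") simp_all
    then obtain m where m: "m > n" "if even k then x m \<le> a else b \<le> x m"
      unfolding frequently_sequentially by (meson Suc_le_eq)
    then obtain j where "m = Suc j" "j \<ge> n" by (cases m) auto
    then show False
      using m(2) const[of j] const[of m] by (auto simp: Let_def split: if_splits)
  qed
qed auto

text \<open>Two levels chosen strictly between liminf and limsup are each passed infinitely often.
  They are taken rational so that later only countably many null sets have to be united. Positivity
  of \<open>p\<close> holds because \<open>ennreal\<close> sends nonpositive reals to 0, which is
  not above the liminf.\<close>

lemma crossings_unbounded_if_not_convergent:
  fixes x :: "nat \<Rightarrow> ennreal"
  assumes "liminf x < limsup x"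
  shows "\<exists>p q::rat. 0 < p \<and> p < q \<and>
    (\<forall>k. \<exists>n. k \<le> crossings (real_of_rat p) (real_of_rat q) x n)"
proof -
  obtain p where p: "liminf x < ennreal (real_of_rat p)" "ennreal (real_of_rat p) < limsup x"
    using ennreal_rat_dense[OF assms] by auto
  obtain q where q: "ennreal (real_of_rat p) < ennreal (real_of_rat q)"
    "ennreal (real_of_rat q) < limsup x"
    using ennreal_rat_dense[OF p(2)] by auto
  have "0 < real_of_rat p"
    using p(1) by (metis ennreal_neg leI not_less_zero)
  moreover have "real_of_rat p < real_of_rat q"
    using q(1) calculation by (simp add: ennreal_less_iff)
  moreover have "frequently (\<lambda>n. x n \<le> ennreal (real_of_rat p)) sequentially"
  proof (rule ccontr)
    assume "\<not> ?thesis"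
    then have "eventually (\<lambda>n. ennreal (real_of_rat p) \<le> x n) sequentially"
      by (auto simp: not_frequently elim: eventually_mono)
    then show False using Liminf_bounded p(1) leD by blast
  qed
  moreover have "frequently (\<lambda>n. ennreal (real_of_rat q) \<le> x n) sequentially"
  proof (rule ccontr)
    assume "\<not> ?thesis"
    then have "eventually (\<lambda>n. x n \<le> ennreal (real_of_rat q)) sequentially"
      by (auto simp: not_frequently elim: eventually_mono)
    then show False using Limsup_bounded q(2) leD by blast
  qed
  ultimately show ?thesis
    by (intro exI[of _ p] exI[of _ q] conjI allI crossings_unbounded)
      (simp_all add: of_rat_less)
qed

section \<open>Almost sure convergence of nonnegative supermartingales\<close>

text \<open>The supermartingale property is stated through integrals over events of
  \<open>H n\<close>. In \<open>ennreal\<close> these always make sense, so no conditional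
  expectation and no integrability of later terms enters.\<close>

locale nn_supermartingale = prob_space M for M :: "'a measure" +
  fixes H :: "nat \<Rightarrow> 'a measure" and X :: "nat \<Rightarrow> 'a \<Rightarrow> ennreal"
  assumes subalg: "\<And>n. subalgebra M (H n)"
    and sets_mono: "\<And>n. sets (H n) \<subseteq> sets (H (Suc n))"
    and adapted: "\<And>n. X n \<in> borel_measurable (H n)"
    and decreasing: "\<And>n A. A \<in> sets (H n) \<Longrightarrow>
      (\<integral>\<^sup>+\<omega>. X (Suc n) \<omega> * indicator A \<omega> \<partial>M) \<le> (\<integral>\<^sup>+\<omega>. X n \<omega> * indicator A \<omega> \<partial>M)"
    and finite_start: "(\<integral>\<^sup>+\<omega>. X 0 \<omega> \<partial>M) < \<infinity>"
begin

lemma measurable_X [measurable]: "X n \<in> borel_measurable M"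
  using measurable_from_subalg[OF subalg adapted] .

lemma measurable_next:
  assumes "f \<in> measurable (H n) N" shows "f \<in> measurable (H (Suc n)) N"
proof -
  have "subalgebra (H (Suc n)) (H n)"
    using subalg sets_mono unfolding subalgebra_def by metis
  then show ?thesis using assms by (rule measurable_from_subalg)
qed

lemma measurable_crossings:
  "(\<lambda>\<omega>. crossings a b (\<lambda>k. X k \<omega>) n) \<in> measurable (H n) (count_space UNIV)"
proof (induction n)
  case (Suc n)
  have [measurable]: "(\<lambda>\<omega>. crossings a b (\<lambda>k. X k \<omega>) n) \<in> measurable (H (Suc n)) (count_space UNIV)"
    using Suc by (rule measurable_next)
  have [measurable]: "X (Suc n) \<in> borel_measurable (H (Suc n))" by (rule adapted)
  show ?case unfolding crossings.simps Let_def by measurable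
qed simp

lemma measurable_crossings' [measurable]:
  "(\<lambda>\<omega>. crossings a b (\<lambda>k. X k \<omega>) n) \<in> measurable M (count_space UNIV)"
  using measurable_from_subalg[OF subalg measurable_crossings] .

text \<open>The wealth of a gambler who starts with \<open>a\<close>, buys at or below \<open>a\<close> and sells at or above
  \<open>b\<close>, keeping the excess.\<close>

definition wealth :: "real \<Rightarrow> real \<Rightarrow> nat \<Rightarrow> 'a \<Rightarrow> ennreal" where
  "wealth a b n \<omega> = (let s = crossings a b (\<lambda>k. X k \<omega>) n in
     ennreal (b - a) * of_nat (s div 2) + (if even s then ennreal a else X n \<omega>))"

text \<open>Whether a share is held between times \<open>n\<close> and \<open>Suc n\<close> is an
  event of \<open>H n\<close>, so \<open>decreasing\<close> shows that holding it does not raise the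
  expected wealth. Cash stays as it is, and trades at time \<open>Suc n\<close> never gain.\<close>

lemma wealth_le:
  assumes ab: "0 < a" "a < b"
  shows "(\<integral>\<^sup>+\<omega>. wealth a b n \<omega> \<partial>M) \<le> ennreal a"
proof (induction n)
  case 0
  show ?case by (simp add: wealth_def emeasure_space_1)
next
  case (Suc n)
  let ?s = "\<lambda>\<omega>. crossings a b (\<lambda>k. X k \<omega>) n"
  let ?base = "\<lambda>\<omega>. ennreal (b - a) * of_nat (?s \<omega> div 2) + (if even (?s \<omega>) then ennreal a else 0)"
  let ?A = "{\<omega>\<in>space M. odd (?s \<omega>)}"
  have A: "?A \<in> sets (H n)"
  proof -
    have "space (H n) = space M" using subalg[of n] by (simp add: subalgebra_def)
    moreover have "{\<omega>\<in>space (H n). odd (?s \<omega>)} \<in> sets (H n)"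
      using measurable_crossings[of a b n] by measurable
    ultimately show ?thesis by simp
  qed
  then have [measurable]: "?A \<in> sets M"
    using subalg[of n] by (auto simp: subalgebra_def)
  \<comment> \<open>A purchase turns \<open>a\<close> into a share worth at most \<open>a\<close>. A
    sale completes a round and turns a share worth at least \<open>b\<close> into \<open>a\<close>
    plus the banked excess \<open>b - a\<close>.\<close>
  have "wealth a b (Suc n) \<omega> \<le> ?base \<omega> + X (Suc n) \<omega> * indicator ?A \<omega>" if "\<omega> \<in> space M" for \<omega>
  proof (cases "even (?s \<omega>)")
    case True
    then show ?thesis using that by (auto simp: wealth_def Let_def)
  next
    case False
    have "ennreal (b - a) * of_nat (Suc (?s \<omega>) div 2) + ennreal a
        = ennreal (b - a) * of_nat (?s \<omega> div 2) + ennreal b"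
      using False ab by (auto elim!: oddE simp: algebra_simps simp flip: ennreal_plus)
    then show ?thesis using False that by (auto simp: wealth_def Let_def intro: add_left_mono)
  qed
  then have "(\<integral>\<^sup>+\<omega>. wealth a b (Suc n) \<omega> \<partial>M)
      \<le> (\<integral>\<^sup>+\<omega>. ?base \<omega> + X (Suc n) \<omega> * indicator ?A \<omega> \<partial>M)"
    by (rule nn_integral_mono)
  also have "\<dots> = (\<integral>\<^sup>+\<omega>. ?base \<omega> \<partial>M) + (\<integral>\<^sup>+\<omega>. X (Suc n) \<omega> * indicator ?A \<omega> \<partial>M)"
    by (rule nn_integral_add) measurable
  also have "\<dots> \<le> (\<integral>\<^sup>+\<omega>. ?base \<omega> \<partial>M) + (\<integral>\<^sup>+\<omega>. X n \<omega> * indicator ?A \<omega> \<partial>M)"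
    by (intro add_left_mono decreasing A)
  also have "\<dots> = (\<integral>\<^sup>+\<omega>. ?base \<omega> + X n \<omega> * indicator ?A \<omega> \<partial>M)"
    by (rule nn_integral_add[symmetric]) measurable
  also have "\<dots> = (\<integral>\<^sup>+\<omega>. wealth a b n \<omega> \<partial>M)"
    by (rule nn_integral_cong) (auto simp: wealth_def Let_def)
  finally show ?case using Suc by simp
qed

text \<open>Every completed round banks \<open>b - a\<close>, while the expected wealth never
  exceeds \<open>a\<close>. By monotone convergence the total number of rounds has finite
  mean.\<close>

lemma AE_crossings_bounded:
  assumes ab: "0 < a" "a < b"
  shows "AE \<omega> in M. \<exists>k. \<forall>n. crossings (ennreal a) (ennreal b) (\<lambda>k. X k \<omega>) n < k"
proof -
  let ?s = "\<lambda>\<omega>. crossings a b (\<lambda>k. X k \<omega>)"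
  let ?f = "\<lambda>n \<omega>. ennreal (b - a) * of_nat (?s \<omega> n div 2)"
  have "(\<integral>\<^sup>+\<omega>. (SUP n. ?f n \<omega>) \<partial>M) = (SUP n. \<integral>\<^sup>+\<omega>. ?f n \<omega> \<partial>M)"
  proof (rule nn_integral_monotone_convergence_SUP)
    show "incseq ?f"
      using incseqD[OF crossings_mono]
      by (auto simp: incseq_def le_fun_def intro!: mult_left_mono div_le_mono)
  qed measurable
  also have "\<dots> \<le> ennreal a"
  proof (rule SUP_least)
    fix n
    have "(\<integral>\<^sup>+\<omega>. ?f n \<omega> \<partial>M) \<le> (\<integral>\<^sup>+\<omega>. wealth a b n \<omega> \<partial>M)"
      by (rule nn_integral_mono) (auto simp: wealth_def Let_def)
    then show "(\<integral>\<^sup>+\<omega>. ?f n \<omega> \<partial>M) \<le> ennreal a"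
      using wealth_le[OF ab, of n] by simp
  qed
  finally have "(\<integral>\<^sup>+\<omega>. (SUP n. ?f n \<omega>) \<partial>M) \<noteq> \<infinity>"
    using ennreal_less_top[of a] by (auto simp: top_unique)
  then have "AE \<omega> in M. (SUP n. ?f n \<omega>) \<noteq> \<infinity>"
    by (intro nn_integral_PInf_AE) measurable
  then show ?thesis
  proof eventually_elim
    case (elim \<omega>)
    then obtain c where c: "(SUP n. ?f n \<omega>) = ennreal c" "c \<ge> 0"
      by (cases "SUP n. ?f n \<omega>") auto
    obtain k :: nat where k: "c / (b - a) < k" using reals_Archimedean2 by blast
    \<comment> \<open>The state counts half rounds, whence the factor 2.\<close>
    have "?s \<omega> n < 2 * k" for n
    proof -
      have "?f n \<omega> \<le> ennreal c" using c by (metis SUP_upper UNIV_I)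
      then have "(b - a) * (?s \<omega> n div 2) \<le> c"
        using ab c(2) by (simp only: ennreal_of_nat_eq_real_of_nat flip: ennreal_mult)
          (simp add: ennreal_le_iff)
      then have "real (?s \<omega> n div 2) \<le> c / (b - a)"
        using ab by (simp add: pos_le_divide_eq mult.commute)
      then have "?s \<omega> n div 2 < k" using k by linarith
      then show ?thesis by simp
    qed
    then show ?case by blast
  qed
qed

theorem AE_convergent: "AE \<omega> in M. \<exists>L. (\<lambda>n. X n \<omega>) \<longlonglongrightarrow> ennreal L"
proof -
  have "AE \<omega> in M. \<forall>p q::rat. 0 < p \<and> p < q \<longrightarrow> 
      (\<exists>k. \<forall>n. crossings (real_of_rat p) (real_of_rat q) (\<lambda>k. X k \<omega>) n < k)"
    unfolding AE_all_countable
  proof (intro allI)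
    fix p q :: rat
    show "AE \<omega> in M. 0 < p \<and> p < q \<longrightarrow> 
      (\<exists>k. \<forall>n. crossings (real_of_rat p) (real_of_rat q) (\<lambda>k. X k \<omega>) n < k)"
      using AE_crossings_bounded[of "real_of_rat p" "real_of_rat q"]
      by (cases "0 < p \<and> p < q") (auto simp: of_rat_less)
  qed
  \<comment> \<open>Fatou's lemma rules out the limit \<infinity>: all means are bounded by the
    finite initial one.\<close>
  moreover have "AE \<omega> in M. liminf (\<lambda>n. X n \<omega>) \<noteq> \<infinity>"
  proof (rule nn_integral_PInf_AE)
    have "(\<integral>\<^sup>+\<omega>. X n \<omega> \<partial>M) \<le> (\<integral>\<^sup>+\<omega>. X 0 \<omega> \<partial>M)" for n
    proof (induction n)
      case (Suc n)
      have "space M \<in> sets (H n)"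
        using subalg[of n] sets.top[of "H n"] by (simp add: subalgebra_def)
      from decreasing[OF this] have "(\<integral>\<^sup>+\<omega>. X (Suc n) \<omega> \<partial>M) \<le> (\<integral>\<^sup>+\<omega>. X n \<omega> \<partial>M)"
        by (simp cong: nn_integral_cong)
      then show ?case using Suc by simp
    qed simp
    then have "liminf (\<lambda>n. \<integral>\<^sup>+\<omega>. X n \<omega> \<partial>M) \<le> (\<integral>\<^sup>+\<omega>. X 0 \<omega> \<partial>M)"
      by (intro Liminf_le) auto
    moreover have "(\<integral>\<^sup>+\<omega>. liminf (\<lambda>n. X n \<omega>) \<partial>M) \<le> liminf (\<lambda>n. \<integral>\<^sup>+\<omega>. X n \<omega> \<partial>M)"
      by (rule nn_integral_liminf) measurable
    ultimately show "(\<integral>\<^sup>+\<omega>. liminf (\<lambda>n. X n \<omega>) \<partial>M) \<noteq> \<infinity>"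
      using finite_start by (auto simp: top_unique)
  qed measurable
  ultimately show ?thesis
  proof eventually_elim
    case (elim \<omega>)
    let ?x = "\<lambda>n. X n \<omega>"
    have "\<not> liminf ?x < limsup ?x"
      using crossings_unbounded_if_not_convergent[of ?x] elim(1) by (meson leD)
    then have "liminf ?x = limsup ?x"
      using Liminf_le_Limsup[of sequentially ?x] by (simp add: order_less_le)
    then have "?x \<longlonglongrightarrow> liminf ?x" by (simp add: tendsto_iff_Liminf_eq_Limsup)
    then show ?case using elim(2) by (cases "liminf ?x") auto
  qed
qed

end

section \<open>Perturbed contractions and the weights\<close>

lemma contraction_tendsto_zero:
  fixes e w :: "nat \<Rightarrow> real"
  assumes d: "0 \<le> d" "d < 1" and e: "\<And>n. 0 \<le> e n" "\<And>n. e (Suc n) \<le> d * e n + w n"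
    and w: "w \<longlonglongrightarrow> 0"
  shows "e \<longlonglongrightarrow> 0"
proof (rule LIMSEQ_I)
  fix \<epsilon> :: real assume "0 < \<epsilon>"
  define \<delta> where "\<delta> = \<epsilon> / 2"
  have "0 < \<delta>" using \<open>0 < \<epsilon>\<close> by (simp add: \<delta>_def)
  \<comment> \<open>The threshold makes \<delta> the fixed point of
    \<open>t \<mapsto> d * t + \<delta> * (1 - d)\<close>, so the bound below survives the induction
    step.\<close>
  then have "\<forall>\<^sub>F n in sequentially. w n < \<delta> * (1 - d)"
    using d by (intro order_tendstoD[OF w]) simp
  then obtain N where N: "w n < \<delta> * (1 - d)" if "n \<ge> N" for n
    by (auto simp: eventually_sequentially)
  have bound: "e (k + N) \<le> d ^ k * e N + \<delta>" for k
  proof (induction k)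
    case (Suc k)
    have "e (Suc k + N) \<le> d * e (k + N) + \<delta> * (1 - d)"
      using e(2)[of "k + N"] N[of "k + N"] by simp
    also have "\<dots> \<le> d * (d ^ k * e N + \<delta>) + \<delta> * (1 - d)"
      using Suc d by (intro add_right_mono mult_left_mono) auto
    finally show ?case by (simp add: algebra_simps)
  qed (use \<open>0 < \<delta>\<close> in simp)
  have "(\<lambda>k. d ^ k * e N) \<longlonglongrightarrow> 0 * e N"
    using d by (intro tendsto_intros LIMSEQ_power_zero) auto
  then have "\<forall>\<^sub>F k in sequentially. d ^ k * e N < \<delta>"
    using \<open>0 < \<delta>\<close> by (intro order_tendstoD(2)) simp_all
  then obtain k\<^sub>0 where k\<^sub>0: "d ^ k * e N < \<delta>" if "k \<ge> k\<^sub>0" for k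
    by (auto simp: eventually_sequentially)
  have "norm (e n - 0) < \<epsilon>" if "n \<ge> k\<^sub>0 + N" for n
  proof -
    have "d ^ (n - N) * e N < \<delta>" using that by (intro k\<^sub>0) simp
    then show ?thesis using bound[of "n - N"] that e(1)[of n] by (simp add: \<delta>_def)
  qed
  then show "\<exists>n0. \<forall>n\<ge>n0. norm (e n - 0) < \<epsilon>" by blast
qed

locale bounded_coefficients =
  fixes y :: "nat \<Rightarrow> real" and d :: real
  assumes y: "\<And>n. 0 < y n" "\<And>n. y n \<le> d" and d: "d < 1"
begin

definition weight :: "nat \<Rightarrow> real" where
  "weight n = (\<Sum>k. \<Prod>i<k. y (n + i))"

lemma d_pos: "0 < d"
  using y(1)[of 0] y(2)[of 0] by linarith

lemma weight_term_bounds: "0 \<le> (\<Prod>i<k. y (n + i))" "(\<Prod>i<k. y (n + i)) \<le> d ^ k"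
proof -
  show "0 \<le> (\<Prod>i<k. y (n + i))" by (intro prod_nonneg) (use y(1) in \<open>simp add: less_imp_le\<close>)
  have "(\<Prod>i<k. y (n + i)) \<le> (\<Prod>i<k. d)"
    using y by (intro prod_mono) (auto intro: less_imp_le)
  then show "(\<Prod>i<k. y (n + i)) \<le> d ^ k" by simp
qed

lemma summable_weight_terms: "summable (\<lambda>k. \<Prod>i<k. y (n + i))"
proof (rule summable_comparison_test')
  show "summable (\<lambda>k. d ^ k)" using d d_pos by (intro summable_geometric) simp
  show "norm (\<Prod>i<k. y (n + i)) \<le> d ^ k" for k
    using weight_term_bounds[where n = n and k = k] by simp
qed

text \<open>Split off the empty product and factor \<open>y n\<close> out of the others. The
  recursion is what makes \<open>potential_drift\<close> an identity.\<close>

lemma weight_rec: "weight n = 1 + y n * weight (Suc n)"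
proof -
  have "weight n = (\<Sum>k. \<Prod>i<Suc k. y (n + i)) + 1"
    unfolding weight_def using suminf_split_head[OF summable_weight_terms[of n]] by simp
  also have "(\<Sum>k. \<Prod>i<Suc k. y (n + i)) = (\<Sum>k. y n * (\<Prod>i<k. y (Suc n + i)))"
    by (simp only: prod.lessThan_Suc_shift) simp
  also have "\<dots> = y n * weight (Suc n)"
    unfolding weight_def by (rule suminf_mult[OF summable_weight_terms])
  finally show ?thesis by simp
qed

lemma weight_le: "weight n \<le> 1 / (1 - d)"
proof -
  have "weight n \<le> (\<Sum>k. d ^ k)"
    unfolding weight_def using d d_pos
    by (intro suminf_le weight_term_bounds summable_weight_terms summable_geometric) simp
  then show ?thesis using d d_pos by (simp add: suminf_geometric)
qed

lemma weight_ge_1: "1 \<le> weight n"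
proof -
  have "0 \<le> weight (Suc n)"
    unfolding weight_def by (intro suminf_nonneg weight_term_bounds summable_weight_terms)
  then show ?thesis using weight_rec[of n] y(1)[of n] by simp
qed

lemma tendsto_of_weighted:
  fixes x :: "nat \<Rightarrow> real"
  assumes "(\<lambda>n. x n + weight n * (x (Suc n) - x n)) \<longlonglongrightarrow> u"
  shows "x \<longlonglongrightarrow> u"
proof -
  let ?U = "\<lambda>n. x n + weight n * (x (Suc n) - x n)"
  have "(\<lambda>n. \<bar>x n - u\<bar>) \<longlonglongrightarrow> 0"
  proof (rule contraction_tendsto_zero)
    show "(\<lambda>n. \<bar>?U n - u\<bar>) \<longlonglongrightarrow> 0"
      using tendsto_diff[OF assms tendsto_const[of u]] by (simp add: tendsto_rabs_zero)
    fix n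
    \<comment> \<open>With this \<open>t\<close>, the point \<open>x (Suc n)\<close> is the convex
      combination of \<open>x n\<close> and \<open>?U n\<close> with weights \<open>1 - t\<close>
      and \<open>t\<close>. The upper bound on \<open>weight n\<close> yields the contraction factor
      \<open>1 - t \<le> d\<close>.\<close>
    define t where "t = 1 / weight n"
    have w: "1 \<le> weight n" "weight n \<le> 1 / (1 - d)" by (fact weight_ge_1 weight_le)+
    have t: "t \<le> 1" "1 - d \<le> t" "0 \<le> t"
      using w d by (auto simp: t_def field_simps)
    have "x (Suc n) - u = (1 - t) * (x n - u) + t * (?U n - u)"
      using w by (simp add: t_def field_simps)
    then have "\<bar>x (Suc n) - u\<bar> \<le> (1 - t) * \<bar>x n - u\<bar> + t * \<bar>?U n - u\<bar>"
      using t by (metis abs_mult abs_of_nonneg abs_triangle_ineq diff_ge_0_iff_ge)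
    also have "\<dots> \<le> d * \<bar>x n - u\<bar> + 1 * \<bar>?U n - u\<bar>"
      using t by (intro add_mono mult_right_mono) auto
    finally show "\<bar>x (Suc n) - u\<bar> \<le> d * \<bar>x n - u\<bar> + \<bar>?U n - u\<bar>" by simp
  qed (use d d_pos in auto)
  then show ?thesis by (simp add: LIM_zero_iff tendsto_rabs_zero_iff)
qed

end

section \<open>The potential and its truncation to a nonnegative supermartingale\<close>

locale inertial_supermartingale = prob_space M + bounded_coefficients y d
  for M :: "'a measure" and y d +
  fixes G :: "nat \<Rightarrow> 'a measure" and r \<beta> \<eta> :: "nat \<Rightarrow> 'a \<Rightarrow> real"
  assumes subalg: "\<And>n. subalgebra M (G n)"
    and sets_mono: "\<And>m n. m \<le> n \<Longrightarrow> sets (G m) \<subseteq> sets (G n)"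
    and r_adapted: "\<And>n. r n \<in> borel_measurable (G n)"
    and \<beta>_adapted: "\<And>n. \<beta> n \<in> borel_measurable (G (Suc n))"
    and \<eta>_adapted: "\<And>n. \<eta> n \<in> borel_measurable (G (Suc n))"
    and r_nonneg: "\<And>n. AE \<omega> in M. 0 \<le> r n \<omega>"
    and \<beta>_nonneg: "\<And>n. AE \<omega> in M. 0 \<le> \<beta> n \<omega>"
    and \<eta>_nonneg: "\<And>n. AE \<omega> in M. 0 \<le> \<eta> n \<omega>"
    and drift: "\<And>n. AE \<omega> in M. nonneg_cond_exp M (G (Suc n)) (r (Suc (Suc n))) \<omega>
      \<le> ereal (((1 + y n) * r (Suc n) \<omega> - y n * r n \<omega>) + \<beta> n \<omega> - \<eta> n \<omega>)"
begin

lemma measurable_mono: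
  assumes "f \<in> measurable (G m) N" "m \<le> n"
  shows "f \<in> measurable (G n) N"
proof -
  have "subalgebra (G n) (G m)"
    using subalg sets_mono[OF assms(2)] unfolding subalgebra_def by metis
  then show ?thesis using assms(1) by (rule measurable_from_subalg)
qed

lemma measurable_r [measurable]: "r n \<in> borel_measurable M"
  using measurable_from_subalg[OF subalg r_adapted] .

definition potential :: "nat \<Rightarrow> 'a \<Rightarrow> real" where
  "potential n \<omega> = r n \<omega> + weight n * (r (Suc n) \<omega> - r n \<omega>)"

definition cumulated :: "nat \<Rightarrow> 'a \<Rightarrow> real" where
  "cumulated n \<omega> = (\<Sum>k<n. weight (Suc k) * (\<beta> k \<omega> - \<eta> k \<omega>))"

text \<open>The bounds reach \<open>r (Suc n)\<close> and \<open>\<beta> n\<close>, the latest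
  values known to \<open>G (Suc n)\<close>. Up to a null set the events decrease in
  \<open>n\<close>, so they serve in place of a stopping time.\<close>

definition tame :: "real \<Rightarrow> nat \<Rightarrow> 'a set" where
  "tame K n = {\<omega>\<in>space M. (\<forall>k\<le>Suc n. r k \<omega> \<le> K) \<and> (\<Sum>k\<le>n. \<beta> k \<omega>) \<le> K}"

text \<open>On the tame set \<open>potential n \<ge> - K / (1 - d)\<close> and \<open>cumulated n \<le> K / (1 - d)\<close>, so the
  truncation at \<open>0\<close> built into \<^const>\<open>ennreal\<close> loses nothing.\<close>

definition truncated :: "real \<Rightarrow> nat \<Rightarrow> 'a \<Rightarrow> ennreal" where
  "truncated K n \<omega> =
     ennreal (potential n \<omega> - cumulated n \<omega> + 2 * K / (1 - d)) * indicator (tame K n) \<omega>"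

lemma measurable_cumulated: "cumulated n \<in> borel_measurable (G n)"
proof -
  have "\<beta> k \<in> borel_measurable (G n)" "\<eta> k \<in> borel_measurable (G n)" if "k < n" for k
    using that by (auto intro: measurable_mono[OF \<beta>_adapted] measurable_mono[OF \<eta>_adapted])
  then show ?thesis unfolding cumulated_def[abs_def] by (auto intro!: borel_measurable_sum)
qed

lemma tame_adapted: "tame K n \<in> sets (G (Suc n))"
proof -
  have [measurable]: "r k \<in> borel_measurable (G (Suc n))" if "k \<le> Suc n" for k
    using that by (rule measurable_mono[OF r_adapted])
  have [measurable]: "(\<lambda>\<omega>. \<Sum>k\<le>n. \<beta> k \<omega>) \<in> borel_measurable (G (Suc n))"
    by (intro borel_measurable_sum measurable_mono[OF \<beta>_adapted]) auto
  have "tame K n = (\<Inter>k\<in>{..Suc n}. {\<omega>\<in>space (G (Suc n)). r k \<omega> \<le> K})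
      \<inter> {\<omega>\<in>space (G (Suc n)). (\<Sum>k\<le>n. \<beta> k \<omega>) \<le> K}"
    using subalg[of "Suc n"] by (auto simp: tame_def subalgebra_def)
  also have "\<dots> \<in> sets (G (Suc n))"
    by (intro sets.Int sets.finite_INT) (auto, measurable)
  finally show ?thesis .
qed

lemma truncated_adapted: "truncated K n \<in> borel_measurable (G (Suc n))"
proof -
  have [measurable]: "r n \<in> borel_measurable (G (Suc n))" "r (Suc n) \<in> borel_measurable (G (Suc n))"
    "cumulated n \<in> borel_measurable (G (Suc n))" "tame K n \<in> sets (G (Suc n))"
    by (auto intro: measurable_mono[OF r_adapted] measurable_mono[OF measurable_cumulated] tame_adapted)
  show ?thesis unfolding truncated_def[abs_def] potential_def by measurable
qed

lemma cumulated_le: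
  assumes "m \<le> Suc n" "\<omega> \<in> tame K n" "\<And>k. 0 \<le> \<beta> k \<omega>" "\<And>k. 0 \<le> \<eta> k \<omega>"
  shows "cumulated m \<omega> \<le> K / (1 - d)"
proof -
  have "cumulated m \<omega> \<le> (\<Sum>k<m. 1 / (1 - d) * \<beta> k \<omega>)"
    unfolding cumulated_def
  proof (rule sum_mono)
    fix k
    have "weight (Suc k) * (\<beta> k \<omega> - \<eta> k \<omega>) \<le> weight (Suc k) * \<beta> k \<omega>"
      using assms weight_ge_1[of "Suc k"] by (intro mult_left_mono) auto
    also have "\<dots> \<le> 1 / (1 - d) * \<beta> k \<omega>"
      using assms by (intro mult_right_mono weight_le)
    finally show "weight (Suc k) * (\<beta> k \<omega> - \<eta> k \<omega>) \<le> 1 / (1 - d) * \<beta> k \<omega>" .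
  qed
  also have "\<dots> = 1 / (1 - d) * (\<Sum>k<m. \<beta> k \<omega>)" by (simp add: sum_distrib_left)
  also have "\<dots> \<le> 1 / (1 - d) * (\<Sum>k\<le>n. \<beta> k \<omega>)"
    using assms d by (intro mult_left_mono sum_mono2) auto
  also have "\<dots> \<le> 1 / (1 - d) * K"
    using assms(2) d by (intro mult_left_mono) (auto simp: tame_def)
  finally show ?thesis by simp
qed

lemma weight_bounds_mult:
  assumes "0 \<le> x" "x \<le> K"
  shows "0 \<le> (weight n - 1) * x" "(weight n - 1) * x \<le> K / (1 - d)" "weight n * x \<le> K / (1 - d)"
proof -
  have "weight n * x \<le> 1 / (1 - d) * K"
    using assms weight_le[of n] d by (intro mult_mono) auto
  then show "weight n * x \<le> K / (1 - d)" by simp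
  then show "(weight n - 1) * x \<le> K / (1 - d)" using assms by (simp add: algebra_simps)
  show "0 \<le> (weight n - 1) * x" using assms weight_ge_1[of n] by simp
qed

text \<open>One half of the shift absorbs \<open>(weight - 1) * r\<close>, the other absorbs
  \<open>cumulated\<close>. The second expression is the part of the next shifted value that
  \<open>G (Suc n)\<close> already knows.\<close>

lemma shifted_nonneg:
  assumes "\<omega> \<in> tame K n" "\<And>k. 0 \<le> r k \<omega>" "\<And>k. 0 \<le> \<beta> k \<omega>" "\<And>k. 0 \<le> \<eta> k \<omega>"
  shows "0 \<le> potential n \<omega> - cumulated n \<omega> + 2 * K / (1 - d)" (is ?potential)
    and "0 \<le> (1 - weight (Suc n)) * r (Suc n) \<omega> - cumulated (Suc n) \<omega> + 2 * K / (1 - d)"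
      (is ?predictable)
proof -
  have r: "r n \<omega> \<le> K" "r (Suc n) \<omega> \<le> K" using assms(1) by (auto simp: tame_def)
  have two: "2 * K / (1 - d) = K / (1 - d) + K / (1 - d)" by simp
  have "0 \<le> weight n * r (Suc n) \<omega>"
    using weight_ge_1[of n] assms(2)[of "Suc n"] by simp
  then show ?potential
    using weight_bounds_mult(2)[OF assms(2) r(1), of n] cumulated_le[OF le_SucI[OF order_refl] assms(1,3,4)]
    unfolding potential_def left_diff_distrib right_diff_distrib two by linarith
  show ?predictable
    using weight_bounds_mult(2)[OF assms(2) r(2), of "Suc n"] cumulated_le[OF order_refl assms(1,3,4)]
    unfolding left_diff_distrib right_diff_distrib two by linarith
qed

text \<open>This isolates \<open>r (Suc (Suc n))\<close>, the only value to be averaged given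
  \<open>G (Suc n)\<close>.\<close>

lemma potential_Suc:
  "potential (Suc n) \<omega> = weight (Suc n) * r (Suc (Suc n)) \<omega> + (1 - weight (Suc n)) * r (Suc n) \<omega>"
  by (simp add: potential_def algebra_simps)

text \<open>The left side is \<open>potential (Suc n) - cumulated (Suc n)\<close> with
  \<open>r (Suc (Suc n))\<close> replaced by its conditional bound. By \<open>weight_rec\<close>,
  \<open>y n * weight (Suc n)\<close> equals \<open>weight n - 1\<close>, and the drift
  cancels.\<close>

lemma potential_drift:
  "weight (Suc n) * (((1 + y n) * r (Suc n) \<omega> - y n * r n \<omega>) + \<beta> n \<omega> - \<eta> n \<omega>)
    + (1 - weight (Suc n)) * r (Suc n) \<omega> - cumulated (Suc n) \<omega>
    = potential n \<omega> - cumulated n \<omega>"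
  by (simp add: potential_def cumulated_def weight_rec[of n] algebra_simps)

lemma AE_nonneg: "AE \<omega> in M. (\<forall>k. 0 \<le> r k \<omega>) \<and> (\<forall>k. 0 \<le> \<beta> k \<omega>) \<and> (\<forall>k. 0 \<le> \<eta> k \<omega>)"
  using r_nonneg \<beta>_nonneg \<eta>_nonneg by (simp add: AE_all_countable)

text \<open>The next shifted value is at most \<open>f * r (Suc (Suc n)) + g\<close> with
  nonnegative \<open>f\<close> and \<open>g\<close> known to \<open>G (Suc n)\<close>. Integrating
  against \<open>f\<close> replaces \<open>r (Suc (Suc n))\<close> by its conditional expectation,
  to which \<open>drift\<close> applies.\<close>

lemma truncated_decreasing:
  assumes A: "A \<in> sets (G (Suc n))"
  shows "(\<integral>\<^sup>+\<omega>. truncated K (Suc n) \<omega> * indicator A \<omega> \<partial>M) \<le> (\<integral>\<^sup>+\<omega>. truncated K n \<omega> * indicator A \<omega> \<partial>M)"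
proof -
  interpret sigma_finite_subalgebra M "G (Suc n)"
    by (rule finite_measure_subalgebra_is_sigma_finite)
      (simp add: finite_measure_subalgebra_def finite_measure_subalgebra_axioms_def subalg finite_measure_axioms)
  \<comment> \<open>The event is cut with \<open>tame K n\<close>, known to
    \<open>G (Suc n)\<close>, and not with the smaller \<open>tame K (Suc n)\<close>; the
    enlargement only increases the integral.\<close>
  define B where "B = A \<inter> tame K n"
  define f where "f = (\<lambda>\<omega>. ennreal (weight (Suc n)) * indicator B \<omega> :: ennreal)"
  define g where "g = (\<lambda>\<omega>. ennreal ((1 - weight (Suc n)) * r (Suc n) \<omega> - cumulated (Suc n) \<omega>
    + 2 * K / (1 - d)) * indicator B \<omega>)"
  have [measurable]: "B \<in> sets (G (Suc n))" "r (Suc n) \<in> borel_measurable (G (Suc n))"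
    "cumulated (Suc n) \<in> borel_measurable (G (Suc n))"
    using A tame_adapted r_adapted measurable_cumulated by (auto simp: B_def)
  have f: "f \<in> borel_measurable (G (Suc n))" unfolding f_def by measurable
  have g: "g \<in> borel_measurable (G (Suc n))" unfolding g_def by measurable
  have [measurable]: "f \<in> borel_measurable M" "g \<in> borel_measurable M"
    using measurable_from_subalg[OF subalg] f g by auto
  have "(\<integral>\<^sup>+\<omega>. truncated K (Suc n) \<omega> * indicator A \<omega> \<partial>M)
      \<le> (\<integral>\<^sup>+\<omega>. f \<omega> * ennreal (r (Suc (Suc n)) \<omega>) + g \<omega> \<partial>M)"
  proof (rule nn_integral_mono_AE)
    show "AE \<omega> in M. truncated K (Suc n) \<omega> * indicator A \<omega> \<le> f \<omega> * ennreal (r (Suc (Suc n)) \<omega>) + g \<omega>"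
      using AE_nonneg
    proof eventually_elim
      case (elim \<omega>)
      show ?case
      proof (cases "\<omega> \<in> A \<inter> tame K (Suc n)")
        case True
        have "(\<Sum>k\<le>n. \<beta> k \<omega>) \<le> (\<Sum>k\<le>Suc n. \<beta> k \<omega>)" using elim by simp
        then have t: "\<omega> \<in> tame K n" using True by (force simp: tame_def)
        have "ennreal (potential (Suc n) \<omega> - cumulated (Suc n) \<omega> + 2 * K / (1 - d))
          = ennreal (weight (Suc n)) * ennreal (r (Suc (Suc n)) \<omega>)
            + ennreal ((1 - weight (Suc n)) * r (Suc n) \<omega> - cumulated (Suc n) \<omega> + 2 * K / (1 - d))"
          using shifted_nonneg(2)[OF t] elim weight_ge_1[of "Suc n"]
          by (simp add: potential_Suc algebra_simps flip: ennreal_mult ennreal_plus)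
        then show ?thesis using True t by (simp add: truncated_def f_def g_def B_def)
      next
        case False
        then show ?thesis by (auto simp: truncated_def)
      qed
    qed
  qed
  also have "\<dots> = (\<integral>\<^sup>+\<omega>. f \<omega> * ennreal (r (Suc (Suc n)) \<omega>) \<partial>M) + (\<integral>\<^sup>+\<omega>. g \<omega> \<partial>M)"
    by (rule nn_integral_add) measurable
  also have "(\<integral>\<^sup>+\<omega>. f \<omega> * ennreal (r (Suc (Suc n)) \<omega>) \<partial>M) =
      (\<integral>\<^sup>+\<omega>. f \<omega> * nn_cond_exp M (G (Suc n)) (\<lambda>\<omega>. ennreal (r (Suc (Suc n)) \<omega>)) \<omega> \<partial>M)"
    by (rule nn_cond_exp_intg[symmetric]) (use f in measurable)
  also have "\<dots> + (\<integral>\<^sup>+\<omega>. g \<omega> \<partial>M) =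
      (\<integral>\<^sup>+\<omega>. f \<omega> * nn_cond_exp M (G (Suc n)) (\<lambda>\<omega>. ennreal (r (Suc (Suc n)) \<omega>)) \<omega> + g \<omega> \<partial>M)"
    by (rule nn_integral_add[symmetric]) measurable
  also have "\<dots> \<le> (\<integral>\<^sup>+\<omega>. truncated K n \<omega> * indicator A \<omega> \<partial>M)"
  proof (rule nn_integral_mono_AE)
    show "AE \<omega> in M. f \<omega> * nn_cond_exp M (G (Suc n)) (\<lambda>\<omega>. ennreal (r (Suc (Suc n)) \<omega>)) \<omega> + g \<omega>
        \<le> truncated K n \<omega> * indicator A \<omega>"
      using AE_nonneg drift[of n]
    proof eventually_elim
      case (elim \<omega>)
      show ?case
      proof (cases "\<omega> \<in> B")
        case True
        define x where "x = ((1 + y n) * r (Suc n) \<omega> - y n * r n \<omega>) + \<beta> n \<omega> - \<eta> n \<omega>"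
        let ?e = "nn_cond_exp M (G (Suc n)) (\<lambda>\<omega>. ennreal (r (Suc (Suc n)) \<omega>)) \<omega>"
        let ?W = "(1 - weight (Suc n)) * r (Suc n) \<omega> - cumulated (Suc n) \<omega> + 2 * K / (1 - d)"
        have e: "enn2ereal ?e \<le> ereal x" using elim(2) by (simp add: nonneg_cond_exp_def x_def)
        \<comment> \<open>A bound on a nonnegative conditional expectation is itself nonnegative, so
          passing to \<open>ennreal x\<close> truncates nothing.\<close>
        have "0 \<le> ereal x" using enn2ereal_nonneg e by (rule order_trans)
        then have x: "0 \<le> x" by simp
        then have "?e \<le> ennreal x"
          using e by (simp add: less_eq_ennreal.rep_eq enn2ereal_ennreal)
        then have "ennreal (weight (Suc n)) * ?e + ennreal ?W
            \<le> ennreal (weight (Suc n)) * ennreal x + ennreal ?W"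
          by (intro add_right_mono mult_left_mono) auto
        also have "\<dots> = ennreal (weight (Suc n) * x + ?W)"
          using shifted_nonneg(2)[of \<omega> K n] elim(1) True weight_ge_1[of "Suc n"] x
          by (simp add: B_def flip: ennreal_mult ennreal_plus)
        also have "weight (Suc n) * x + ?W = potential n \<omega> - cumulated n \<omega> + 2 * K / (1 - d)"
          using potential_drift[of n \<omega>] unfolding x_def by linarith
        finally show ?thesis using True by (simp add: f_def g_def truncated_def B_def)
      next
        case False
        then show ?thesis by (simp add: f_def g_def)
      qed
    qed
  qed
  finally show ?thesis .
qed

lemma truncated_start: "(\<integral>\<^sup>+\<omega>. truncated K 0 \<omega> \<partial>M) < \<infinity>"
proof -
  have "(\<integral>\<^sup>+\<omega>. truncated K 0 \<omega> \<partial>M) \<le> (\<integral>\<^sup>+\<omega>. ennreal (3 * K / (1 - d)) \<partial>M)"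
  proof (rule nn_integral_mono_AE)
    show "AE \<omega> in M. truncated K 0 \<omega> \<le> ennreal (3 * K / (1 - d))"
      using AE_nonneg
    proof eventually_elim
      case (elim \<omega>)
      show ?case
      proof (cases "\<omega> \<in> tame K 0")
        case True
        then have r: "r 0 \<omega> \<le> K" "r (Suc 0) \<omega> \<le> K" by (auto simp: tame_def)
        \<comment> \<open>Two of the three units \<open>K / (1 - d)\<close> are the shift, and the
          third bounds \<open>weight 0 * r (Suc 0)\<close>; \<open>cumulated 0\<close> is 0.\<close>
        have "potential 0 \<omega> - cumulated 0 \<omega> + 2 * (K / (1 - d)) \<le> 3 * (K / (1 - d))"
          using weight_bounds_mult(1)[of "r 0 \<omega>" K 0] weight_bounds_mult(3)[of "r (Suc 0) \<omega>" K 0] r elim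
          by (simp add: potential_def cumulated_def left_diff_distrib right_diff_distrib)
        then show ?thesis using True by (simp add: truncated_def ennreal_leI)
      qed (simp add: truncated_def)
    qed
  qed
  also have "\<dots> < \<infinity>" by (simp add: emeasure_space_1)
  finally show ?thesis .
qed

lemma AE_truncated_convergent: "AE \<omega> in M. \<exists>L. (\<lambda>n. truncated K n \<omega>) \<longlonglongrightarrow> ennreal L"
proof -
  \<comment> \<open>The filtration is shifted because \<open>truncated K n\<close> involves
    \<open>r (Suc n)\<close>.\<close>
  interpret nn_supermartingale M "\<lambda>n. G (Suc n)" "truncated K"
    by unfold_locales
      (auto intro: subalg truncated_adapted truncated_decreasing truncated_start[simplified]
        subsetD[OF sets_mono[of "Suc n" "Suc (Suc n)" for n]])
  show ?thesis by (rule AE_convergent)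
qed

section \<open>From the supermartingale limit to single paths\<close>

lemma pathwise_convergent_summable:
  assumes nonneg: "\<And>k. 0 \<le> r k \<omega>" "\<And>k. 0 \<le> \<beta> k \<omega>" "\<And>k. 0 \<le> \<eta> k \<omega>"
    and tame: "\<And>n. \<omega> \<in> tame K n"
    and lim: "(\<lambda>n. truncated K n \<omega>) \<longlonglongrightarrow> ennreal L"
    and summable_\<beta>: "summable (\<lambda>k. \<beta> k \<omega>)"
  shows "convergent (\<lambda>n. r n \<omega>)" "summable (\<lambda>k. \<eta> k \<omega>)"
proof -
  let ?A = "1 / (1 - d)"
  let ?V = "\<lambda>n. potential n \<omega> - cumulated n \<omega> + 2 * K / (1 - d)"
  \<comment> \<open>\<open>ennreal L\<close> determines \<open>L\<close> only up to truncation at 0,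
    hence the maximum.\<close>
  have "?V \<longlonglongrightarrow> max 0 L"
  proof (rule tendsto_ennrealD)
    have "(\<lambda>n. truncated K n \<omega>) = (\<lambda>n. ennreal (?V n))"
      using tame by (simp add: truncated_def)
    moreover have "ennreal (max 0 L) = ennreal L" by (simp add: ennreal_neg max_def)
    ultimately show "(\<lambda>n. ennreal (?V n)) \<longlonglongrightarrow> ennreal (max 0 L)"
      using lim by simp
    show "\<forall>\<^sub>F n in sequentially. 0 \<le> ?V n"
      using shifted_nonneg(1)[OF tame nonneg] by simp
  qed auto
  then have V: "convergent ?V" by (auto simp: convergent_def)
  then obtain C where C: "\<bar>?V n\<bar> \<le> C" for n
    using convergent_imp_Bseq[OF V] by (auto simp: Bseq_def)
  have K: "0 \<le> K" using nonneg(1)[of 0] tame[of 0] by (auto simp: tame_def intro: order_trans)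
  have weight_summable: "summable (\<lambda>k. weight (Suc k) * \<beta> k \<omega>)"
  proof (rule summable_comparison_test')
    show "summable (\<lambda>k. ?A * \<beta> k \<omega>)" using summable_\<beta> by (rule summable_mult)
    show "norm (weight (Suc n) * \<beta> n \<omega>) \<le> ?A * \<beta> n \<omega>" for n
      using mult_right_mono[OF weight_le nonneg(2)] nonneg(2)[of n] weight_ge_1[of "Suc n"]
      by (simp add: abs_mult)
  qed
  have cumulated_eq: "cumulated n \<omega>
      = (\<Sum>k<n. weight (Suc k) * \<beta> k \<omega>) - (\<Sum>k<n. weight (Suc k) * \<eta> k \<omega>)" for n
    by (simp add: cumulated_def right_diff_distrib sum_subtractf)
  have summable_\<eta>: "summable (\<lambda>k. weight (Suc k) * \<eta> k \<omega>)"
  proof (rule summableI_nonneg_bounded)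
    show "0 \<le> weight (Suc n) * \<eta> n \<omega>" for n
      using nonneg(3)[of n] weight_ge_1[of "Suc n"] by simp
    \<comment> \<open>By \<open>cumulated_eq\<close> and the definition of \<open>?V\<close>, the
      left side equals the partial \<beta> sum plus
      \<open>?V n - potential n \<omega> - 2 * K / (1 - d)\<close>.\<close>
    show "(\<Sum>k<n. weight (Suc k) * \<eta> k \<omega>) \<le> C + (\<Sum>k. weight (Suc k) * \<beta> k \<omega>) + K / (1 - d)" for n
    proof -
      have "(\<Sum>k<n. weight (Suc k) * \<beta> k \<omega>) \<le> (\<Sum>k. weight (Suc k) * \<beta> k \<omega>)"
        using nonneg(2) weight_ge_1 by (intro sum_le_suminf weight_summable)
          (auto intro!: mult_nonneg_nonneg intro: order_trans[OF zero_le_one])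
      moreover have "- (K / (1 - d)) \<le> potential n \<omega>"
      proof -
        have "r n \<omega> \<le> K" using tame[of n] by (auto simp: tame_def)
        moreover have "0 \<le> weight n * r (Suc n) \<omega>"
          using weight_ge_1[of n] nonneg(1)[of "Suc n"] by simp
        ultimately show ?thesis
          using weight_bounds_mult(2)[of "r n \<omega>" K n] nonneg(1)[of n]
          unfolding potential_def left_diff_distrib right_diff_distrib by linarith
      qed
      moreover have "0 \<le> 2 * K / (1 - d)" using K d by simp
      ultimately show ?thesis using C[of n] cumulated_eq[of n] by linarith
    qed
  qed
  then show "summable (\<lambda>k. \<eta> k \<omega>)"
  proof (rule summable_comparison_test'[where N = 0])
    fix n
    have "1 * \<eta> n \<omega> \<le> weight (Suc n) * \<eta> n \<omega>"
      using nonneg weight_ge_1 by (intro mult_right_mono)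
    then show "norm (\<eta> n \<omega>) \<le> weight (Suc n) * \<eta> n \<omega>" using nonneg(3)[of n] by simp
  qed
  have "(\<lambda>n. cumulated n \<omega>) \<longlonglongrightarrow> (\<Sum>k. weight (Suc k) * \<beta> k \<omega>) - (\<Sum>k. weight (Suc k) * \<eta> k \<omega>)"
    unfolding cumulated_eq by (intro tendsto_diff summable_LIMSEQ weight_summable summable_\<eta>)
  with \<open>?V \<longlonglongrightarrow> max 0 L\<close> have "(\<lambda>n. ?V n + cumulated n \<omega> - 2 * K / (1 - d)) \<longlonglongrightarrow>
    max 0 L + ((\<Sum>k. weight (Suc k) * \<beta> k \<omega>) - (\<Sum>k. weight (Suc k) * \<eta> k \<omega>)) - 2 * K / (1 - d)"
    by (intro tendsto_diff tendsto_add tendsto_const)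
  then have "(\<lambda>n. potential n \<omega>) \<longlonglongrightarrow>
    max 0 L + ((\<Sum>k. weight (Suc k) * \<beta> k \<omega>) - (\<Sum>k. weight (Suc k) * \<eta> k \<omega>)) - 2 * K / (1 - d)"
    by simp
  then show "convergent (\<lambda>n. r n \<omega>)"
    unfolding potential_def by (rule convergentI[OF tendsto_of_weighted])
qed

theorem AE_convergent_summable:
  assumes "AE \<omega> in M. bdd_above (range (\<lambda>n. r n \<omega>))" "AE \<omega> in M. summable (\<lambda>k. \<beta> k \<omega>)"
  shows "AE \<omega> in M. convergent (\<lambda>n. r n \<omega>) \<and> summable (\<lambda>k. \<eta> k \<omega>)"
proof -
  \<comment> \<open>Only natural bounds \<open>K\<close> are used, so that the null sets remain
    countable in number.\<close>
  have "AE \<omega> in M. \<forall>K::nat. \<exists>L. (\<lambda>n. truncated (real K) n \<omega>) \<longlonglongrightarrow> ennreal L"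
    unfolding AE_all_countable using AE_truncated_convergent by blast
  with assms AE_nonneg AE_space show ?thesis
  proof eventually_elim
    case (elim \<omega>)
    obtain C where C: "r n \<omega> \<le> C" for n
      using elim(1) by (auto simp: bdd_above_def)
    obtain K :: nat where K: "max C (\<Sum>k. \<beta> k \<omega>) \<le> K" using real_arch_simple by blast
    have "(\<Sum>k\<le>n. \<beta> k \<omega>) \<le> (\<Sum>k. \<beta> k \<omega>)" for n
      using elim by (intro sum_le_suminf) auto
    then have "(\<Sum>k\<le>n. \<beta> k \<omega>) \<le> K" "r n \<omega> \<le> K" for n
      using K C[of n] by (auto intro: order_trans[of _ C] order_trans[of _ "\<Sum>k. \<beta> k \<omega>"])
    then have tame: "\<omega> \<in> tame K n" for n
      using elim by (simp add: tame_def)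
    obtain L where "(\<lambda>n. truncated (real K) n \<omega>) \<longlonglongrightarrow> ennreal L" using elim by blast
    with pathwise_convergent_summable[of \<omega> "real K" L] elim tame show ?case by blast
  qed
qed

end

theorem lemma8:
  fixes M :: "'a measure"
    and F :: "nat \<Rightarrow> 'a measure"
    and r \<beta> \<eta> :: "nat \<Rightarrow> 'a \<Rightarrow> real"
    and y :: "nat \<Rightarrow> real"
    and c d :: real
  assumes "prob_space M"
    and "filtration (space M) (\<lambda>n. F (Suc n))"
    and "\<And>n. n \<ge> 1 \<Longrightarrow> subalgebra M (F n)"
    and "\<And>n. n \<ge> 1 \<Longrightarrow> r n \<in> borel_measurable (F n)"
    and "\<And>n. n \<ge> 1 \<Longrightarrow> AE \<omega> in M. r n \<omega> \<ge> 0"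
    and "AE \<omega> in M. bdd_above ((\<lambda>n. \<bar>r n \<omega>\<bar>) ` {1..})"
    and "\<And>n. n \<ge> 1 \<Longrightarrow> \<beta> n \<in> borel_measurable (F (n + 1))"
    and "\<And>n. n \<ge> 1 \<Longrightarrow> \<eta> n \<in> borel_measurable (F (n + 1))"
    and "\<And>n. n \<ge> 1 \<Longrightarrow> AE \<omega> in M. \<beta> n \<omega> > 0"
    and "\<And>n. n \<ge> 1 \<Longrightarrow> AE \<omega> in M. \<eta> n \<omega> > 0"
    and "\<And>n. n \<ge> 1 \<Longrightarrow> AE \<omega> in M.
           nonneg_cond_exp M (F (n + 1)) (r (n + 2)) \<omega>
             \<le> ereal (((1 + y n) * r (n + 1) \<omega> - y n * r n \<omega>) + \<beta> n \<omega> - \<eta> n \<omega>)"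
    and "{c..d} \<subseteq> {0<..<1}"
    and "\<And>n. n \<ge> 1 \<Longrightarrow> y n \<in> {c..d}"
    and "AE \<omega> in M. summable (\<lambda>k. \<beta> (Suc k) \<omega>)"
  shows "(\<exists>R \<in> borel_measurable M. AE \<omega> in M. (\<lambda>n. r n \<omega>) \<longlonglongrightarrow> (R \<omega> :: real)) \<and>
         (AE \<omega> in M. summable (\<lambda>k. \<eta> (Suc k) \<omega>))"
proof -
  interpret prob_space M by fact
  have y: "c \<le> y (Suc n)" "y (Suc n) \<le> d" for n using assms(13)[of "Suc n"] by auto
  then have "c \<le> d" by (rule order_trans)
  then have cd: "0 < c" "d < 1" using assms(12) by auto
  \<comment> \<open>All indices move down by one: time 0 of the locale is time 1 here.\<close>
  interpret inertial_supermartingale M "\<lambda>n. y (Suc n)" d "\<lambda>n. F (Suc n)" "\<lambda>n. r (Suc n)"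
    "\<lambda>n. \<beta> (Suc n)" "\<lambda>n. \<eta> (Suc n)"
  proof
    show "sets (F (Suc m)) \<subseteq> sets (F (Suc n))" if "m \<le> n" for m n
      using assms(2) that by (simp add: filtration_def)
    fix n
    show "0 < y (Suc n)" using y(1)[of n] cd by simp
    show "AE \<omega> in M. 0 \<le> \<beta> (Suc n) \<omega>" using assms(9)[of "Suc n"] by (auto elim: eventually_mono)
    show "AE \<omega> in M. 0 \<le> \<eta> (Suc n) \<omega>" using assms(10)[of "Suc n"] by (auto elim: eventually_mono)
    show "AE \<omega> in M. nonneg_cond_exp M (F (Suc (Suc n))) (r (Suc (Suc (Suc n)))) \<omega>
      \<le> ereal ((1 + y (Suc n)) * r (Suc (Suc n)) \<omega> - y (Suc n) * r (Suc n) \<omega> + \<beta> (Suc n) \<omega> - \<eta> (Suc n) \<omega>)"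
      using assms(11)[of "Suc n"] by simp
  qed (use assms(3-5,7,8)[of "Suc _"] y cd in auto)
  have "AE \<omega> in M. bdd_above (range (\<lambda>n. r (Suc n) \<omega>))"
    using assms(6)
  proof eventually_elim
    case (elim \<omega>)
    then obtain C where "\<bar>r n \<omega>\<bar> \<le> C" if "n \<ge> 1" for n by (auto simp: bdd_above_def)
    then show ?case by (intro bdd_aboveI[of _ C]) (auto intro: abs_le_D1)
  qed
  from AE_convergent_summable[OF this assms(14)]
  have AE: "AE \<omega> in M. convergent (\<lambda>n. r (Suc n) \<omega>)" "AE \<omega> in M. summable (\<lambda>k. \<eta> (Suc k) \<omega>)"
    by (auto elim: eventually_mono)
  \<comment> \<open>\<open>lim\<close> is total, so this is measurable on the whole space; its value
    off the convergence set, a null set, is immaterial.\<close>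
  let ?R = "\<lambda>\<omega>. lim (\<lambda>n. r (Suc n) \<omega>)"
  have "?R \<in> borel_measurable M" by (intro borel_measurable_lim_metric measurable_r)
  moreover have "AE \<omega> in M. (\<lambda>n. r n \<omega>) \<longlonglongrightarrow> ?R \<omega>"
    using AE(1)
  proof eventually_elim
    case (elim \<omega>)
    then have "(\<lambda>n. r (Suc n) \<omega>) \<longlonglongrightarrow> ?R \<omega>" by (simp add: convergent_LIMSEQ_iff)
    then show ?case by (rule LIMSEQ_imp_Suc)
  qed
  ultimately show ?thesis using AE(2) by (intro conjI bexI[of _ ?R])
qed

end
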